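(* There exists a testing algorithm for monotonicity of distributions over $[n]$ in the Cumulative Dual access model with query complexity $\tilde{O}(1/\varepsilon^4)$ (independent of $n$): given $n$, $\varepsilon\in(0,1]$ and Cumulative Dual access to an unknown distribution $D$ over $[n]$, it outputs ACCEPT with probability at least $2/3$ if $D$ is monotone and REJECT with probability at least $2/3$ if $d_{TV}(D,\mathcal{M})\ge\varepsilon$.
   Context: A distribution over $[n]$ is monotone if $D(1)\ge\dots\ge D(n)$; $\mathcal{M}$ is the class of such distributions; $d_{TV}(D_1,D_2)=\frac12\sum_x|D_1(x)-D_2(x)|$, $d_{TV}(D,\mathcal{M})=\inf_{D'\in\mathcal{M}}d_{TV}(D,D')$. Cumulative Dual access to $D$ consists of two oracles: a sampling oracle ${\sf SAMP}$ returning $x\in[n]$ with probability $D(x)$ independently of previous calls, and a cumulative evaluation oracle ${\sf CEVAL}$ which on input $j\in[n]$ returns $D(\{1,\dots,j\})=\sum_{i\le j}D(i)$. $\tilde{O}(\cdot)$ hides polylogarithmic factors in its argument. *)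

theory Defs
  imports "HOL-Probability.Probability"
begin

text \<open>Distributions over \<open>[n] = {1..n}\<close>, as mass functions on the naturals supported in \<open>{1..n}\<close>.\<close>

definition distributions :: "nat \<Rightarrow> nat pmf set" where
  "distributions n = {D. set_pmf D \<subseteq> {1..n}}"

definition monotone_distributions :: "nat \<Rightarrow> nat pmf set" where
  "monotone_distributions n = {D \<in> distributions n. antimono_on {1..n} (pmf D)}"

definition d_TV :: "nat \<Rightarrow> nat pmf \<Rightarrow> nat pmf \<Rightarrow> real" where
  "d_TV n D1 D2 = (1 / 2) * (\<Sum>x\<in>{1..n}. \<bar>pmf D1 x - pmf D2 x\<bar>)"

definition d_TV_monotone :: "nat \<Rightarrow> nat pmf \<Rightarrow> real" where
  "d_TV_monotone n D = (INF D' \<in> monotone_distributions n. d_TV n D D')"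

datatype verdict = ACCEPT | REJECT

text \<open>
  A tester is an adaptive randomized query strategy, represented as a well-founded tree.
  An internal node either draws from the tester's private randomness (which is not a query),
  calls the sampling oracle, or calls the cumulative evaluation oracle on a point; in each case
  the strategy continues as a function of the value obtained. The unknown distribution
  is not a parameter of the tree, so the tester learns about it through the oracles only.
\<close>

datatype tester =
    Output verdict
  | Draw "nat pmf" "nat \<Rightarrow> tester"
  | Samp "nat \<Rightarrow> tester"
  | Ceval nat "real \<Rightarrow> tester"

definition ceval :: "nat pmf \<Rightarrow> nat \<Rightarrow> real" where
  "ceval D j = (\<Sum>i\<in>{1..j}. pmf D i)"

text \<open>
  The joint distribution of the verdict and the number of oracle calls made when a tester is run
  with Cumulative Dual access to \<open>D\<close>. A query to \<open>ceval\<close> at a point outside \<open>[n]\<close> is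
  harmless: it is counted, and it returns 0 or 1 whatever the distribution over \<open>[n]\<close> is.
\<close>

primrec run :: "nat pmf \<Rightarrow> tester \<Rightarrow> (verdict \<times> nat) pmf" where
  "run D (Output v) = return_pmf (v, 0)"
| "run D (Draw R f) = bind_pmf R (\<lambda>r. run D (f r))"
| "run D (Samp f) = bind_pmf D (\<lambda>x. map_pmf (apsnd Suc) (run D (f x)))"
| "run D (Ceval j f) = map_pmf (apsnd Suc) (run D (f (ceval D j)))"

definition verdict_prob :: "nat pmf \<Rightarrow> tester \<Rightarrow> verdict \<Rightarrow> real" where
  "verdict_prob D T v = measure_pmf.prob (run D T) {r. fst r = v}"

text \<open>Worst case over all executions of positive probability.\<close>

definition makes_at_most_queries :: "nat pmf \<Rightarrow> tester \<Rightarrow> real \<Rightarrow> bool" where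
  "makes_at_most_queries D T b \<longleftrightarrow> (\<forall>(v, q) \<in> set_pmf (run D T). real q \<le> b)"

text \<open>
  The functions in soft-O of \<open>x\<close>, for arguments \<open>x \<ge> 1\<close>, are those bounded by \<open>soft_O_bound C k x\<close>
  for some constants \<open>C\<close> and \<open>k\<close>; the summand 1 keeps the bound positive at \<open>x = 1\<close>.
\<close>

definition soft_O_bound :: "real \<Rightarrow> nat \<Rightarrow> real \<Rightarrow> real" where
  "soft_O_bound C k x = C * x * (1 + ln x) ^ k"

end

theory Submission
  imports Defs
begin

text \<open>
  Partition the positive integers into cells \<open>{b k<..b (k + 1)}\<close> whose lengths grow like \<open>\<delta> * b k\<close>, and let
  \<open>a k\<close> be the average of \<open>D\<close> over cell \<open>k\<close>, which costs two cumulative queries. The deficit of cell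
  \<open>k\<close> is the sum of the positive parts of \<open>a k - D z\<close> over all \<open>z \<le> b (k + 1)\<close>. For monotone \<open>D\<close> only
  the \<open>z\<close> in the cell itself contribute and, as in Birge's oblivious decomposition, Abel summation
  bounds the total deficit by \<open>2 * \<delta>\<close>. Conversely, replacing
  \<open>D\<close> on each cell by the largest average over that cell and the later ones, and normalizing, gives
  a monotone distribution within twice the total deficit of \<open>D\<close>.

  To estimate the total deficit, sample \<open>x\<close> from \<open>D\<close>, say in cell \<open>k\<close>, and compare
  \<open>a k\<close> with \<open>D z\<close> for a uniform \<open>z \<le> b (k + 1)\<close>. Since \<open>b (k + 1)\<close> is at most about \<open>1 / \<delta>\<close> times
  the length of cell \<open>k\<close>, the importance weights are \<open>O(1 / \<delta>)\<close>, so a score in \<open>[0, 1]\<close> has mean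
  \<open>\<delta> / 2\<close> times the total deficit. With \<open>\<delta> = \<epsilon> / 16\<close> this mean is at most \<open>\<delta>\<^sup>2\<close> or at least \<open>4 * \<delta>\<^sup>2\<close>,
  which \<open>O(1 / \<delta>\<^sup>2)\<close> trials distinguish by a Chernoff bound.
\<close>

declare One_nat_def [simp del]

subsection \<open>Distance to monotonicity\<close>

lemma sum_pmf_distributions:
  assumes "D \<in> distributions n"
  shows "(\<Sum>x\<in>{1..n}. pmf D x) = 1"
  using assms by (intro sum_pmf_eq_1) (auto simp: distributions_def)

lemma d_TV_nonneg: "0 \<le> d_TV n D E"
  by (simp add: d_TV_def sum_nonneg)

lemma d_TV_monotone_le:
  assumes "E \<in> monotone_distributions n"
  shows "d_TV_monotone n D \<le> d_TV n D E"
  unfolding d_TV_monotone_def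
  by (rule cINF_lower[OF _ assms]) (auto intro!: bdd_belowI[of _ 0] simp: d_TV_nonneg)

lemma d_TV_le_1:
  assumes "D \<in> distributions n" "E \<in> distributions n"
  shows "d_TV n D E \<le> 1"
proof -
  have "(\<Sum>x\<in>{1..n}. \<bar>pmf D x - pmf E x\<bar>) \<le> (\<Sum>x\<in>{1..n}. pmf D x + pmf E x)"
    by (intro sum_mono) (smt (verit) pmf_nonneg)
  also have "\<dots> = 2"
    using assms by (simp add: sum.distrib sum_pmf_distributions)
  finally show ?thesis by (simp add: d_TV_def)
qed

lemma ex_monotone_distribution:
  assumes nonneg: "\<And>x. g x \<ge> 0"
    and anti: "antimono_on {1..n} g" and pos: "(\<Sum>x\<in>{1..n}. g x) > (0::real)"
  obtains E where "E \<in> monotone_distributions n"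
    "\<And>x. x \<in> {1..n} \<Longrightarrow> pmf E x = g x / (\<Sum>x\<in>{1..n}. g x)"
proof -
  define G where "G = (\<Sum>x\<in>{1..n}. g x)"
  define f where "f = (\<lambda>x. if x \<in> {1..n} then g x / G else 0)"
  have "G > 0" using pos by (simp add: G_def)
  have f0: "f x \<ge> 0" for x using nonneg \<open>G > 0\<close> by (simp add: f_def)
  have "(\<integral>\<^sup>+x. ennreal (f x) \<partial>count_space UNIV) = (\<Sum>x\<in>{1..n}. ennreal (f x))"
    by (rule nn_integral_count_space'[where A = "{1..n}"]) (auto simp: f_def)
  also have "\<dots> = ennreal (\<Sum>x\<in>{1..n}. f x)"
    using f0 by (simp add: sum_ennreal)
  also have "(\<Sum>x\<in>{1..n}. f x) = 1"
    using \<open>G > 0\<close> by (simp add: f_def G_def flip: sum_divide_distrib)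
  finally have pmf: "pmf (embed_pmf f) x = f x" for x
    by (intro pmf_embed_pmf f0) simp
  have "set_pmf (embed_pmf f) \<subseteq> {1..n}"
    by (auto simp: set_pmf_eq pmf) (auto simp: f_def split: if_splits)
  moreover have "antimono_on {1..n} (pmf (embed_pmf f))"
    using anti \<open>G > 0\<close> by (auto simp: monotone_on_def pmf) (auto simp: f_def divide_right_mono)
  ultimately have "embed_pmf f \<in> monotone_distributions n"
    by (simp add: monotone_distributions_def distributions_def)
  then show ?thesis
    by (rule that) (simp only: pmf, simp add: f_def G_def)
qed

text \<open>Normalizing \<open>g\<close> moves it by \<open>\<bar>G - 1\<bar>\<close> in total,
  where \<open>G\<close> is its mass, and this is at most the sum on the right because
  \<open>D\<close> has mass 1. The resulting factor 2 cancels the 1/2 in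
  \<open>d_TV\<close>.\<close>

lemma d_TV_monotone_le_sum:
  assumes n: "n \<ge> 1" and D: "D \<in> distributions n" and nonneg: "\<And>x. g x \<ge> 0"
    and anti: "antimono_on {1..n} g"
  shows "d_TV_monotone n D \<le> (\<Sum>x\<in>{1..n}. \<bar>pmf D x - g x\<bar>)"
proof -
  define G where "G = (\<Sum>x\<in>{1..n}. g x)"
  have "G \<ge> 0" unfolding G_def by (intro sum_nonneg nonneg)
  have G1: "\<bar>G - 1\<bar> \<le> (\<Sum>x\<in>{1..n}. \<bar>pmf D x - g x\<bar>)"
    using sum_abs[of "\<lambda>x. pmf D x - g x" "{1..n}"]
    by (simp add: sum_subtractf sum_pmf_distributions[OF D] G_def)
  show ?thesis
  proof (cases "G = 0")
    \<comment> \<open>A \<open>g\<close> of mass 0 cannot be normalized, but then the right side is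
      at least 1, which bounds every distance.\<close>
    case True
    obtain E where E: "E \<in> monotone_distributions n"
      using ex_monotone_distribution[of "\<lambda>_. 1" n] n by (auto simp: monotone_on_def)
    have "d_TV_monotone n D \<le> 1"
      using d_TV_monotone_le[OF E, of D] d_TV_le_1[OF D, of E] E
      by (simp add: monotone_distributions_def)
    with G1 True show ?thesis by simp
  next
    case False
    then have "G > 0" using \<open>G \<ge> 0\<close> by simp
    then obtain E where E: "E \<in> monotone_distributions n"
      and pmf: "\<And>x. x \<in> {1..n} \<Longrightarrow> pmf E x = g x / G"
      using ex_monotone_distribution[OF nonneg anti] unfolding G_def by auto
    have "(\<Sum>x\<in>{1..n}. \<bar>pmf D x - pmf E x\<bar>) \<le>
        (\<Sum>x\<in>{1..n}. \<bar>pmf D x - g x\<bar> + g x * \<bar>G - 1\<bar> / G)"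
    proof (rule sum_mono)
      fix x assume "x \<in> {1..n}"
      have "g x - g x / G = g x * (G - 1) / G"
        using \<open>G > 0\<close> by (simp add: field_simps)
      then have "\<bar>g x - g x / G\<bar> = g x * \<bar>G - 1\<bar> / G"
        using \<open>G > 0\<close> nonneg[of x] by (simp add: abs_mult)
      then show "\<bar>pmf D x - pmf E x\<bar> \<le> \<bar>pmf D x - g x\<bar> + g x * \<bar>G - 1\<bar> / G"
        using pmf[OF \<open>x \<in> {1..n}\<close>] abs_triangle_ineq[of "pmf D x - g x" "g x - g x / G"]
        by simp
    qed
    also have "\<dots> = (\<Sum>x\<in>{1..n}. \<bar>pmf D x - g x\<bar>) + \<bar>G - 1\<bar>"
      using \<open>G > 0\<close>
      by (simp add: sum.distrib G_def[symmetric] flip: sum_divide_distrib sum_distrib_right)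
    finally have "d_TV n D E \<le> (\<Sum>x\<in>{1..n}. \<bar>pmf D x - g x\<bar>)"
      using G1 by (simp add: d_TV_def)
    then show ?thesis using d_TV_monotone_le[OF E, of D] by linarith
  qed
qed

subsection \<open>Partitions into intervals\<close>

definition cell :: "(nat \<Rightarrow> nat) \<Rightarrow> nat \<Rightarrow> nat" where
  "cell b x = (LEAST k. x \<le> b (Suc k))"

text \<open>Written through \<open>ceval\<close>, so that the tester obtains it from two cumulative
  queries.\<close>

definition average :: "nat pmf \<Rightarrow> nat \<Rightarrow> nat \<Rightarrow> real" where
  "average D u v = (ceval D v - ceval D u) / real (v - u)"

text \<open>Letting \<open>z\<close> run over the earlier cells as well makes this quantity register
  a rise of \<open>D\<close> from earlier points to cell \<open>k\<close>, not only unevenness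
  inside the cell.\<close>

definition deficit :: "(nat \<Rightarrow> nat) \<Rightarrow> nat pmf \<Rightarrow> nat \<Rightarrow> real" where
  "deficit b D k = (\<Sum>z\<in>{1..b (Suc k)}. max 0 (average D (b k) (b (Suc k)) - pmf D z))"

lemma ceval_diff:
  assumes "u \<le> v"
  shows "ceval D v - ceval D u = (\<Sum>x\<in>{u<..v}. pmf D x)"
proof -
  have "{1..v} = {1..u} \<union> {u<..v}" using assms by auto
  then have "ceval D v = ceval D u + (\<Sum>x\<in>{u<..v}. pmf D x)"
    unfolding ceval_def by (simp add: sum.union_disjoint ivl_disj_int)
  then show ?thesis by simp
qed

lemma average_eq:
  assumes "u < v"
  shows "average D u v = (\<Sum>x\<in>{u<..v}. pmf D x) / real (v - u)"
  using assms by (simp add: average_def ceval_diff)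

lemma average_nonneg: "0 \<le> average D u v"
proof (cases "u < v")
  case True
  then show ?thesis by (simp add: average_eq sum_nonneg)
qed (simp add: average_def)

lemma ceval_diff_single:
  assumes "z \<ge> 1"
  shows "ceval D z - ceval D (z - 1) = pmf D z"
proof -
  have "{z - 1<..z} = {z}" using assms by auto
  then show ?thesis by (simp add: ceval_diff)
qed

context
  fixes b :: "nat \<Rightarrow> nat"
  assumes b_0: "b 0 = 0" and b_strict: "strict_mono b"
begin

lemma b_less_Suc: "b k < b (Suc k)"
  using b_strict by (simp add: strict_mono_Suc_iff)

lemma b_mono: "i \<le> j \<Longrightarrow> b i \<le> b j"
  using b_strict by (simp add: strict_mono_less_eq)

lemma le_b: "k \<le> b k"
  using b_strict by (rule strict_mono_imp_increasing)

lemma le_b_Suc_cell: "x \<le> b (Suc (cell b x))"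
  unfolding cell_def by (rule LeastI[of _ x]) (use le_b[of "Suc x"] in simp)

lemma b_cell_less:
  assumes "x \<ge> 1"
  shows "b (cell b x) < x"
proof (cases "cell b x")
  case 0
  then show ?thesis using assms b_0 by simp
next
  case (Suc j)
  then have "\<not> x \<le> b (Suc j)"
    unfolding cell_def by (intro not_less_Least) simp
  then show ?thesis using Suc by simp
qed

lemma cell_less_iff:
  assumes "x \<ge> 1"
  shows "cell b x < k \<longleftrightarrow> x \<le> b k"
  using b_cell_less[OF assms] le_b_Suc_cell[of x] b_mono[of "Suc (cell b x)" k] b_mono[of k "cell b x"]
  by (meson Suc_leI le_trans leD linorder_not_less)

lemma cell_eq:
  assumes "b k < x" "x \<le> b (Suc k)"
  shows "cell b x = k"
proof -
  have "x \<ge> 1" using assms by simp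
  then have "cell b x < Suc k" "\<not> cell b x < k"
    using assms by (auto simp: cell_less_iff)
  then show ?thesis by simp
qed

lemma cell_mono:
  assumes "1 \<le> x" "x \<le> y"
  shows "cell b x \<le> cell b y"
  using assms cell_less_iff[of x "Suc (cell b y)"] le_b_Suc_cell[of y] by simp

lemma sum_cells:
  fixes f :: "nat \<Rightarrow> real"
  shows "(\<Sum>x\<in>{1..b K}. f x) = (\<Sum>k<K. \<Sum>x\<in>{b k<..b (Suc k)}. f x)"
proof (induction K)
  case (Suc K)
  have "{1..b (Suc K)} = {1..b K} \<union> {b K<..b (Suc K)}"
    using b_less_Suc[of K] by auto
  then show ?case
    using Suc by (simp add: sum.union_disjoint ivl_disj_int)
qed (simp add: b_0)

lemma sum_atLeast1_b_Suc:
  fixes f :: "nat \<Rightarrow> real"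
  shows "(\<Sum>x\<in>{1..b (Suc k)}. f x) = (\<Sum>x\<in>{1..b k}. f x) + (\<Sum>x\<in>{b k<..b (Suc k)}. f x)"
  by (simp add: sum_cells)

section \<open>Deficits of a monotone distribution\<close>

lemma average_le_pmf:
  assumes D: "antimono_on {1..} (pmf D)" and z: "1 \<le> z" "z \<le> Suc (b k)"
  shows "average D (b k) (b (Suc k)) \<le> pmf D z"
proof -
  have "(\<Sum>x\<in>{b k<..b (Suc k)}. pmf D x) \<le> (\<Sum>x\<in>{b k<..b (Suc k)}. pmf D z)"
    by (intro sum_mono monotone_onD[OF D]) (use z in auto)
  then show ?thesis
    using b_less_Suc[of k] by (simp add: average_eq pos_divide_le_eq mult.commute)
qed

text \<open>Terms from earlier cells vanish, since those points are at least as heavy as the average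
  of the cell. Each term inside the cell is at most the drop from its first to its last
  point.\<close>

lemma deficit_le_of_antimono:
  assumes D: "antimono_on {1..} (pmf D)"
  shows "deficit b D k \<le>
    real (b (Suc k) - b k) * (pmf D (Suc (b k)) - pmf D (b (Suc k)))"
proof -
  have avg: "average D (b k) (b (Suc k)) \<le> pmf D (Suc (b k))"
    by (rule average_le_pmf[OF D]) auto
  have "max 0 (average D (b k) (b (Suc k)) - pmf D z) = 0" if "z \<in> {1..b k}" for z
    using average_le_pmf[OF D, of z k] that by simp
  then have "deficit b D k = (\<Sum>z\<in>{b k<..b (Suc k)}. max 0 (average D (b k) (b (Suc k)) - pmf D z))"
    unfolding deficit_def sum_atLeast1_b_Suc by simp
  also have "\<dots> \<le> (\<Sum>z\<in>{b k<..b (Suc k)}. pmf D (Suc (b k)) - pmf D (b (Suc k)))"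
  proof (rule sum_mono)
    fix z assume z: "z \<in> {b k<..b (Suc k)}"
    then have "pmf D (b (Suc k)) \<le> pmf D z" "pmf D (b (Suc k)) \<le> pmf D (Suc (b k))"
      by (auto intro!: monotone_onD[OF D])
    then show "max 0 (average D (b k) (b (Suc k)) - pmf D z) \<le> pmf D (Suc (b k)) - pmf D (b (Suc k))"
      using avg by linarith
  qed
  also have "\<dots> = real (b (Suc k) - b k) * (pmf D (Suc (b k)) - pmf D (b (Suc k)))"
    by simp
  finally show ?thesis .
qed

text \<open>By Abel summation the left side equals the sum of cell lengths times the value at the
  first point of the next cell, a lower Riemann sum for the right side. The boundary term makes the
  induction close.\<close>

lemma sum_weighted_drops_le:
  assumes D: "antimono_on {1..} (pmf D)"
  shows "(\<Sum>k<K. real (b k) * (pmf D (Suc (b k)) - pmf D (Suc (b (Suc k)))))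
    + real (b K) * pmf D (Suc (b K)) \<le> (\<Sum>x\<in>{1..b K}. pmf D x)"
proof (induction K)
  case (Suc K)
  have "real (b (Suc K) - b K) * pmf D (Suc (b (Suc K))) = (\<Sum>x\<in>{b K<..b (Suc K)}. pmf D (Suc (b (Suc K))))"
    by simp
  also have "\<dots> \<le> (\<Sum>x\<in>{b K<..b (Suc K)}. pmf D x)"
    by (intro sum_mono monotone_onD[OF D]) auto
  finally show ?case
    using Suc b_less_Suc[of K] by (simp add: sum_atLeast1_b_Suc of_nat_diff algebra_simps)
qed (simp add: b_0)

lemma sum_deficit_le:
  assumes D: "antimono_on {1..} (pmf D)" and "\<delta> \<ge> 0"
    and short: "\<And>k. real (b (Suc k)) \<le> real (b k) + 1 + \<delta> * real (b k)"
  shows "(\<Sum>k<K. deficit b D k) \<le> 2 * \<delta>"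
proof -
  have *: "deficit b D k \<le> 2 * \<delta> * (real (b k) * (pmf D (Suc (b k)) - pmf D (Suc (b (Suc k)))))" for k
  proof -
    define d where "d = pmf D (Suc (b k)) - pmf D (b (Suc k))"
    have "d \<ge> 0" unfolding d_def
      using b_less_Suc[of k] by (auto intro!: monotone_onD[OF D])
    have "real (b (Suc k) - b k) * d \<le> 2 * \<delta> * real (b k) * d"
    proof (cases "b (Suc k) = Suc (b k)")
      case True
      then show ?thesis by (simp add: d_def)
    next
      case False
      \<comment> \<open>A cell with at least two points forces 1 \<le> \<delta> * \<open>b k\<close>
        by \<open>short\<close>, so the extra 1 in its length is absorbed by doubling. Singleton
        cells have no drop at all.\<close>
      then have "real (b (Suc k)) \<ge> real (b k) + 2"
        using b_less_Suc[of k] by linarith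
      then have "real (b (Suc k) - b k) \<le> 2 * \<delta> * real (b k)"
        using short[of k] b_less_Suc[of k] by (simp add: of_nat_diff)
      then show ?thesis using \<open>d \<ge> 0\<close> by (rule mult_right_mono)
    qed
    \<comment> \<open>Extending the drop to the first point of the next cell gives the form required
      for Abel summation.\<close>
    also have "\<dots> \<le> 2 * \<delta> * real (b k) * (pmf D (Suc (b k)) - pmf D (Suc (b (Suc k))))"
    proof (rule mult_left_mono)
      have "pmf D (Suc (b (Suc k))) \<le> pmf D (b (Suc k))"
        using b_less_Suc[of k] by (auto intro!: monotone_onD[OF D])
      then show "d \<le> pmf D (Suc (b k)) - pmf D (Suc (b (Suc k)))" by (simp add: d_def)
    qed (use \<open>\<delta> \<ge> 0\<close> in simp)
    finally show ?thesis
      using deficit_le_of_antimono[OF D, of k] by (simp add: d_def mult.assoc)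
  qed
  have "(\<Sum>k<K. deficit b D k)
      \<le> 2 * \<delta> * (\<Sum>k<K. real (b k) * (pmf D (Suc (b k)) - pmf D (Suc (b (Suc k)))))"
    unfolding sum_distrib_left by (intro sum_mono *)
  also have "\<dots> \<le> 2 * \<delta> * 1"
  proof (rule mult_left_mono)
    have "0 \<le> real (b K) * pmf D (Suc (b K))" by simp
    moreover have "(\<Sum>x\<in>{1..b K}. pmf D x) \<le> 1"
      by (simp add: measure_pmf.prob_le_1 flip: measure_measure_pmf_finite)
    ultimately show "(\<Sum>k<K. real (b k) * (pmf D (Suc (b k)) - pmf D (Suc (b (Suc k))))) \<le> 1"
      using sum_weighted_drops_le[OF D, of K] by linarith
  qed (use \<open>\<delta> \<ge> 0\<close> in simp)
  finally show ?thesis by simp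
qed

section \<open>Distance to monotonicity in terms of the deficits\<close>

lemma sum_abs_pmf_minus_average:
  "(\<Sum>x\<in>{b k<..b (Suc k)}. \<bar>pmf D x - average D (b k) (b (Suc k))\<bar>)
    = 2 * (\<Sum>x\<in>{b k<..b (Suc k)}. max 0 (average D (b k) (b (Suc k)) - pmf D x))"
proof -
  define d where "d = average D (b k) (b (Suc k))"
  \<comment> \<open>Deviations from the mean cancel, so their positive and negative parts have the
    same sum.\<close>
  have zero: "(\<Sum>x\<in>{b k<..b (Suc k)}. pmf D x - d) = 0"
    using b_less_Suc[of k] by (simp add: sum_subtractf d_def average_eq)
  have "(\<Sum>x\<in>{b k<..b (Suc k)}. \<bar>pmf D x - d\<bar>)
      = (\<Sum>x\<in>{b k<..b (Suc k)}. 2 * max 0 (d - pmf D x) + (pmf D x - d))"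
    by (intro sum.cong refl) (simp add: max_def abs_if)
  also have "\<dots> = 2 * (\<Sum>x\<in>{b k<..b (Suc k)}. max 0 (d - pmf D x))"
    using zero by (simp add: sum.distrib sum_distrib_left)
  finally show ?thesis unfolding d_def .
qed

text \<open>The witness \<open>g\<close> exceeds \<open>D\<close> at \<open>x\<close> through the
  average of the cell of \<open>x\<close> or of a later cell \<open>k\<close>. In the second case
  \<open>x \<le> b k\<close>, so the excess is one term of \<open>deficit b D k\<close>. The
  deviation from the average of the own cell costs twice the part of the deficit inside that
  cell.\<close>

lemma d_TV_monotone_le_deficit:
  assumes n: "n \<ge> 1" and D: "D \<in> distributions n"
  shows "d_TV_monotone n D \<le> 2 * (\<Sum>k<n. deficit b D k)"
proof -
  define a where "a k = average D (b k) (b (Suc k))" for k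
  \<comment> \<open>The first \<open>n\<close> cells cover \<open>{1..n}\<close> because
    \<open>n \<le> b n\<close>, so the maximum is over a finite nonempty set.\<close>
  define g where "g x = (if x \<in> {1..n} then Max (a ` {cell b x..<n}) else 0)" for x
  have a0: "a k \<ge> 0" for k by (simp add: a_def average_nonneg)
  have cell_n: "cell b x < n" if "x \<in> {1..n}" for x
    using that le_b[of n] by (simp add: cell_less_iff)
  have g_ge: "a (cell b x) \<le> g x" if "x \<in> {1..n}" for x
    using cell_n[OF that] that by (auto simp: g_def)
  have "g x \<ge> 0" for x
    using g_ge[of x] a0[of "cell b x"] by (cases "x \<in> {1..n}") (auto simp: g_def)
  moreover have "antimono_on {1..n} g"
  proof (rule monotone_onI)
    fix x y assume xy: "x \<in> {1..n}" "y \<in> {1..n}" "x \<le> y"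
    then have "a ` {cell b y..<n} \<subseteq> a ` {cell b x..<n}" "a ` {cell b y..<n} \<noteq> {}"
      using cell_mono[of x y] cell_n[of y] by auto
    then have "Max (a ` {cell b y..<n}) \<le> Max (a ` {cell b x..<n})"
      by (intro Max_mono) auto
    then show "g x \<ge> g y" using xy by (simp add: g_def)
  qed
  ultimately have "d_TV_monotone n D \<le> (\<Sum>x\<in>{1..n}. \<bar>pmf D x - g x\<bar>)"
    by (intro d_TV_monotone_le_sum n D)
  also have "\<dots> \<le> (\<Sum>x\<in>{1..n}. \<bar>pmf D x - a (cell b x)\<bar>
      + (\<Sum>k<n. if x \<le> b k then max 0 (a k - pmf D x) else 0))"
  proof (rule sum_mono)
    fix x assume x: "x \<in> {1..n}"
    have "g x \<in> a ` {cell b x..<n}"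
      using cell_n[OF x] x by (auto simp: g_def intro!: Max_in simp del: Max_in)
    then obtain k where k: "cell b x \<le> k" "k < n" "g x = a k" by auto
    let ?f = "\<lambda>k. if x \<le> b k then max 0 (a k - pmf D x) else 0"
    have nonneg: "0 \<le> (\<Sum>k<n. ?f k)" by (intro sum_nonneg) auto
    have "g x - pmf D x \<le> max 0 (a (cell b x) - pmf D x) + (\<Sum>k<n. ?f k)"
    proof (cases "cell b x = k")
      case True
      then show ?thesis using k nonneg by simp
    next
      case False
      then have "x \<le> b k" using k x by (simp flip: cell_less_iff)
      then have "g x - pmf D x \<le> ?f k" using k by simp
      also have "\<dots> \<le> (\<Sum>k<n. ?f k)"
        using k by (intro member_le_sum) auto
      finally show ?thesis by simp
    qed
    then show "\<bar>pmf D x - g x\<bar> \<le> \<bar>pmf D x - a (cell b x)\<bar> + (\<Sum>k<n. ?f k)"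
      using g_ge[OF x] nonneg by linarith
  qed
  \<comment> \<open>Enlarging the range to a whole number of cells allows the sum to be split by
    cells.\<close>
  also have "\<dots> \<le> (\<Sum>x\<in>{1..b n}. \<bar>pmf D x - a (cell b x)\<bar>
      + (\<Sum>k<n. if x \<le> b k then max 0 (a k - pmf D x) else 0))"
    using le_b[of n] by (intro sum_mono2 add_nonneg_nonneg sum_nonneg) auto
  also have "\<dots> = (\<Sum>k<n. \<Sum>x\<in>{b k<..b (Suc k)}. \<bar>pmf D x - a (cell b x)\<bar>)
      + (\<Sum>k<n. \<Sum>x\<in>{1..b n}. if x \<le> b k then max 0 (a k - pmf D x) else 0)"
    by (simp only: sum.distrib sum_cells[symmetric] sum.swap[of _ "{1..b n}"])
  also have "(\<Sum>k<n. \<Sum>x\<in>{b k<..b (Suc k)}. \<bar>pmf D x - a (cell b x)\<bar>)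
      = (\<Sum>k<n. \<Sum>x\<in>{b k<..b (Suc k)}. \<bar>pmf D x - a k\<bar>)"
    by (intro sum.cong refl) (use cell_eq in force)
  also have "\<dots> = (\<Sum>k<n. 2 * (\<Sum>x\<in>{b k<..b (Suc k)}. max 0 (a k - pmf D x)))"
    unfolding a_def sum_abs_pmf_minus_average ..
  also have "(\<Sum>k<n. \<Sum>x\<in>{1..b n}. if x \<le> b k then max 0 (a k - pmf D x) else 0)
      = (\<Sum>k<n. \<Sum>x\<in>{1..b k}. max 0 (a k - pmf D x))"
  proof (rule sum.cong[OF refl])
    fix k assume "k \<in> {..<n}"
    then have "{x \<in> {1..b n}. x \<le> b k} = {1..b k}" using b_mono[of k n] by auto
    then show "(\<Sum>x\<in>{1..b n}. if x \<le> b k then max 0 (a k - pmf D x) else 0)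
        = (\<Sum>x\<in>{1..b k}. max 0 (a k - pmf D x))"
      by (simp flip: sum.inter_filter)
  qed
  also have "(\<Sum>k<n. 2 * (\<Sum>x\<in>{b k<..b (Suc k)}. max 0 (a k - pmf D x)))
      + (\<Sum>k<n. \<Sum>x\<in>{1..b k}. max 0 (a k - pmf D x)) \<le> (\<Sum>k<n. 2 * deficit b D k)"
    unfolding sum.distrib[symmetric]
  proof (rule sum_mono)
    fix k
    have "0 \<le> (\<Sum>x\<in>{1..b k}. max 0 (a k - pmf D x))" by (intro sum_nonneg) simp
    then show "2 * (\<Sum>x\<in>{b k<..b (Suc k)}. max 0 (a k - pmf D x))
      + (\<Sum>x\<in>{1..b k}. max 0 (a k - pmf D x)) \<le> 2 * deficit b D k"
      unfolding deficit_def sum_atLeast1_b_Suc a_def by simp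
  qed
  finally show ?thesis by (simp add: sum_distrib_left)
qed

end

subsection \<open>The tester\<close>

text \<open>Cell \<open>k\<close> is hit with probability average times length, and \<open>z\<close>
  is then chosen with probability 1 / \<open>b (Suc k)\<close>. The weight cancels the length and
  the range of \<open>z\<close>; the remaining average turns the relative shortfall in
  \<open>score\<close> into an absolute one, scaled by \<delta> / 2.\<close>

definition weight :: "(nat \<Rightarrow> nat) \<Rightarrow> real \<Rightarrow> nat \<Rightarrow> real" where
  "weight b \<delta> k = \<delta> * real (b (Suc k)) / (2 * real (b (Suc k) - b k))"

text \<open>The argument \<open>s\<close> carries the total score so far and \<open>t\<close> is the
  threshold. The mass of \<open>z\<close> is read off as a difference of two cumulative
  values.\<close>

primrec repeat_trials :: "(nat \<Rightarrow> nat) \<Rightarrow> real \<Rightarrow> real \<Rightarrow> nat \<Rightarrow> real \<Rightarrow> tester" where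
  "repeat_trials b \<delta> t 0 s = Output (if s \<le> t then ACCEPT else REJECT)"
| "repeat_trials b \<delta> t (Suc m) s =
    Samp (\<lambda>x. let k = cell b x in Draw (pmf_of_set {1..b (Suc k)}) (\<lambda>z.
      Ceval (b k) (\<lambda>p. Ceval (b (Suc k)) (\<lambda>q. Ceval (z - 1) (\<lambda>p'. Ceval z (\<lambda>q'.
        repeat_trials b \<delta> t m (s + weight b \<delta> k *
          max 0 (1 - (q' - p') / ((q - p) / real (b (Suc k) - b k))))))))))"

definition score :: "(nat \<Rightarrow> nat) \<Rightarrow> real \<Rightarrow> nat pmf \<Rightarrow> nat \<Rightarrow> nat \<Rightarrow> real" where
  "score b \<delta> D k z = weight b \<delta> k *
     max 0 (1 - (ceval D z - ceval D (z - 1)) / average D (b k) (b (Suc k)))"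

text \<open>One round with the query count stripped off, so that its mean and range can be studied
  apart from \<open>run\<close>.\<close>

definition trial :: "(nat \<Rightarrow> nat) \<Rightarrow> real \<Rightarrow> nat pmf \<Rightarrow> real pmf" where
  "trial b \<delta> D = bind_pmf D (\<lambda>x.
     map_pmf (score b \<delta> D (cell b x)) (pmf_of_set {1..b (Suc (cell b x))}))"

lemma run_repeat_trials_Suc:
  "run D (repeat_trials b \<delta> t (Suc m) s) =
    bind_pmf (trial b \<delta> D) (\<lambda>y. map_pmf (apsnd ((+) 5)) (run D (repeat_trials b \<delta> t m (s + y))))"
proof -
  \<comment> \<open>A round makes one sampling query and four cumulative ones.\<close>
  have "map_pmf (apsnd Suc) (map_pmf (apsnd Suc) (map_pmf (apsnd Suc) (map_pmf (apsnd Suc)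
      (map_pmf (apsnd Suc) p)))) = map_pmf (apsnd ((+) 5)) p" for p :: "(verdict \<times> nat) pmf"
    unfolding map_pmf_comp by (intro map_pmf_cong refl) (auto simp: apsnd_def map_prod_def)
  then show ?thesis
    by (simp add: trial_def score_def average_def Let_def bind_assoc_pmf bind_map_pmf map_bind_pmf
        del: divide_divide_eq_right)
qed

lemma queries_repeat_trials:
  "(v, q) \<in> set_pmf (run D (repeat_trials b \<delta> t m s)) \<Longrightarrow> q = 5 * m"
proof (induction m arbitrary: s v q)
  case (Suc m)
  then show ?case unfolding run_repeat_trials_Suc by fastforce
qed simp

section \<open>Verdict probabilities and a tail bound\<close>

lemma verdict_prob_eq_pmf: "verdict_prob D T v = pmf (map_pmf fst (run D T)) v"
  by (simp add: verdict_prob_def pmf_map vimage_def)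

lemma verdict_prob_ACCEPT: "verdict_prob D T ACCEPT = 1 - verdict_prob D T REJECT"
proof -
  have "v \<in> {ACCEPT, REJECT}" for v by (cases v) auto
  then have "(\<Sum>v\<in>{ACCEPT, REJECT}. pmf (map_pmf fst (run D T)) v) = 1"
    by (intro sum_pmf_eq_1 finite.intros subsetI)
  then show ?thesis by (simp add: verdict_prob_eq_pmf)
qed

lemma verdict_prob_repeat_trials_Suc:
  "verdict_prob D (repeat_trials b \<delta> t (Suc m) s) v =
    measure_pmf.expectation (trial b \<delta> D) (\<lambda>y. verdict_prob D (repeat_trials b \<delta> t m (s + y)) v)"
proof -
  have "fst \<circ> apsnd f = fst" for f :: "nat \<Rightarrow> nat" by (simp add: fun_eq_iff)
  then show ?thesis
    unfolding verdict_prob_eq_pmf run_repeat_trials_Suc map_bind_pmf pmf.map_comp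
    by (simp add: pmf_bind)
qed

text \<open>The right side is the chord of the convex function \<open>q powr y\<close> over [0, 1].
  Young's inequality supplies it as weighted AM-GM for \<open>q\<close> and 1 with weights
  \<open>y\<close> and \<open>1 - y\<close>.\<close>

lemma powr_le_affine:
  fixes q y :: real
  assumes "q > 0" "0 \<le> y" "y \<le> 1"
  shows "q powr y \<le> 1 + (q - 1) * y"
  using Youngs_inequality_0[of y "1 - y" q 1] assms by (simp add: algebra_simps)

text \<open>A Chernoff bound for both tails: \<open>q = 2\<close> is used for rejection and \<open>q = 1 / 2\<close> for acceptance.\<close>

lemma verdict_prob_repeat_trials_le:
  fixes q :: real
  assumes "q > 0" and fin: "finite (set_pmf (trial b \<delta> D))"
    and range: "set_pmf (trial b \<delta> D) \<subseteq> {0..1}"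
    and base: "\<And>s. (if s \<le> t then ACCEPT else REJECT) = v \<Longrightarrow> 1 \<le> q powr (s - t)"
  shows "verdict_prob D (repeat_trials b \<delta> t m s) v
    \<le> q powr (s - t) * (1 + (q - 1) * measure_pmf.expectation (trial b \<delta> D) id) ^ m"
proof (induction m arbitrary: s)
  \<comment> \<open>With no rounds left the verdict is fixed, and by \<open>base\<close> the power
    of \<open>q\<close> dominates its indicator, as in Markov's inequality.\<close>
  case 0
  then show ?case using base[of s] by (auto simp: verdict_prob_def indicator_def)
next
  case (Suc m)
  define \<mu> where "\<mu> = measure_pmf.expectation (trial b \<delta> D) id"
  note [simp] = integrable_measure_pmf_finite[OF fin]
  have affine: "measure_pmf.expectation (trial b \<delta> D) (\<lambda>y. 1 + (q - 1) * y) = 1 + (q - 1) * \<mu>"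
    by (simp add: \<mu>_def id_def)
  have pos: "q powr y \<le> 1 + (q - 1) * y" if "y \<in> set_pmf (trial b \<delta> D)" for y
    using range that \<open>q > 0\<close> by (intro powr_le_affine) auto
  \<comment> \<open>For \<open>q < 1\<close> the sign of this factor is not evident; it is a mean of
    upper bounds for nonnegative powers of \<open>q\<close>.\<close>
  have "0 \<le> measure_pmf.expectation (trial b \<delta> D) (\<lambda>y. 1 + (q - 1) * y)"
    using pos by (intro integral_nonneg_AE) (auto simp: AE_measure_pmf_iff intro: order_trans[OF powr_ge_zero])
  then have nonneg: "0 \<le> 1 + (q - 1) * \<mu>" by (simp only: affine)
  \<comment> \<open>Condition on the first score \<open>y\<close>: the induction hypothesis at
    \<open>s + y\<close> contributes \<open>q powr y\<close>, which the chord bounds before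
    averaging.\<close>
  have "verdict_prob D (repeat_trials b \<delta> t (Suc m) s) v
      \<le> measure_pmf.expectation (trial b \<delta> D)
          (\<lambda>y. q powr (s - t) * (1 + (q - 1) * \<mu>) ^ m * (1 + (q - 1) * y))"
    unfolding verdict_prob_repeat_trials_Suc
  proof (rule integral_mono_AE)
    show "AE y in trial b \<delta> D. verdict_prob D (repeat_trials b \<delta> t m (s + y)) v
        \<le> q powr (s - t) * (1 + (q - 1) * \<mu>) ^ m * (1 + (q - 1) * y)"
      unfolding AE_measure_pmf_iff
    proof
      fix y assume y: "y \<in> set_pmf (trial b \<delta> D)"
      have "verdict_prob D (repeat_trials b \<delta> t m (s + y)) v
          \<le> q powr (s + y - t) * (1 + (q - 1) * \<mu>) ^ m"
        using Suc[of "s + y"] by (simp only: \<mu>_def)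
      also have "q powr (s + y - t) = q powr (s - t) * q powr y"
        by (simp flip: powr_add add: algebra_simps)
      also have "\<dots> * (1 + (q - 1) * \<mu>) ^ m
          = q powr (s - t) * (1 + (q - 1) * \<mu>) ^ m * q powr y"
        by (simp only: ac_simps)
      also have "\<dots> \<le> q powr (s - t) * (1 + (q - 1) * \<mu>) ^ m * (1 + (q - 1) * y)"
        using pos[OF y] nonneg by (intro mult_left_mono) auto
      finally show "verdict_prob D (repeat_trials b \<delta> t m (s + y)) v
        \<le> q powr (s - t) * (1 + (q - 1) * \<mu>) ^ m * (1 + (q - 1) * y)" .
    qed
  qed simp_all
  also have "\<dots> = q powr (s - t) * (1 + (q - 1) * \<mu>) ^ Suc m"
    unfolding integral_mult_right_zero affine by simp
  finally show ?case by (simp only: \<mu>_def)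
qed

section \<open>Range and mean of a single score\<close>

context
  fixes b :: "nat \<Rightarrow> nat"
  assumes b_0: "b 0 = 0" and b_strict: "strict_mono b"
begin

lemma set_pmf_trial_subset:
  assumes "\<delta> \<ge> 0" and long: "\<And>k. \<delta> * real (b (Suc k)) \<le> 2 * (real (b (Suc k)) - real (b k))"
  shows "set_pmf (trial b \<delta> D) \<subseteq> {0..1}"
proof -
  have "score b \<delta> D k z \<in> {0..1}" for k z
  proof -
    note less = b_less_Suc[OF b_0 b_strict, of k]
    \<comment> \<open>The assumption \<open>long\<close> says exactly that the weight is at most
      1.\<close>
    have "0 \<le> weight b \<delta> k" "weight b \<delta> k \<le> 1"
      using long[of k] less \<open>\<delta> \<ge> 0\<close> by (auto simp: weight_def pos_divide_le_eq of_nat_diff)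
    moreover have "0 \<le> (ceval D z - ceval D (z - 1)) / average D (b k) (b (Suc k))"
      by (simp add: average_nonneg ceval_diff sum_nonneg)
    ultimately show ?thesis
      by (auto simp: score_def intro!: mult_le_one)
  qed
  then show ?thesis by (auto simp: trial_def)
qed

lemma finite_set_pmf_trial:
  assumes "finite (set_pmf D)"
  shows "finite (set_pmf (trial b \<delta> D))"
proof -
  have "finite (set_pmf (pmf_of_set {1..b (Suc k)}))" for k
    using b_less_Suc[OF b_0 b_strict, of k] by (subst set_pmf_of_set) auto
  then show ?thesis using assms by (simp add: trial_def)
qed

lemma expectation_trial:
  assumes D: "D \<in> distributions n"
  shows "measure_pmf.expectation (trial b \<delta> D) id = \<delta> / 2 * (\<Sum>k<n. deficit b D k)"
proof -
  define e where "e k = (\<Sum>z\<in>{1..b (Suc k)}. score b \<delta> D k z) / real (b (Suc k))" for k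
  have pos: "0 < b (Suc k)" for k
    using b_less_Suc[OF b_0 b_strict, of k] by simp
  have ne: "{1..b (Suc k)} \<noteq> {}" for k using pos[of k] by simp
  have "n \<le> b n" by (rule le_b[OF b_0 b_strict])
  then have "set_pmf D \<subseteq> {1..b n}" using D by (auto simp: distributions_def)
  then have "measure_pmf.expectation (trial b \<delta> D) id
      = (\<Sum>x\<in>{1..b n}. pmf D x * e (cell b x))"
    unfolding trial_def using ne
    by (subst pmf_expectation_bind[where A = "{1..b n}"])
       (auto simp: integral_pmf_of_set e_def)
  also have "\<dots> = (\<Sum>k<n. \<Sum>x\<in>{b k<..b (Suc k)}. pmf D x * e k)"
    unfolding sum_cells[OF b_0 b_strict] using cell_eq[OF b_0 b_strict]
    by (intro sum.cong refl) force
  also have "\<dots> = (\<Sum>k<n. \<delta> / 2 * deficit b D k)"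
  proof (intro sum.cong refl)
    fix k
    let ?d = "average D (b k) (b (Suc k))"
    have less: "b k < b (Suc k)" by (rule b_less_Suc[OF b_0 b_strict])
    have mass: "(\<Sum>x\<in>{b k<..b (Suc k)}. pmf D x) = ?d * real (b (Suc k) - b k)"
      using less by (simp add: average_eq)
    \<comment> \<open>When the average is 0 both sides vanish, the right one because
      \<open>h \<ge> 0\<close>; this settles the division by zero in \<open>score\<close>.\<close>
    have *: "?d * max 0 (1 - h / ?d) = max 0 (?d - h)" if "h \<ge> 0" for h
    proof (cases "?d = 0")
      case False
      then have "?d > 0" using average_nonneg[of D "b k" "b (Suc k)"] by linarith
      then show ?thesis by (simp add: max_mult_distrib_left right_diff_distrib)
    qed (use that in simp)
    have e_eq: "e k = weight b \<delta> k
        * (\<Sum>z\<in>{1..b (Suc k)}. max 0 (1 - pmf D z / ?d)) / real (b (Suc k))"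
      by (simp add: e_def score_def ceval_diff_single sum_distrib_left)
    have "(\<Sum>x\<in>{b k<..b (Suc k)}. pmf D x * e k) = ?d * real (b (Suc k) - b k) * e k"
      by (simp only: sum_distrib_right[symmetric] mass)
    also have "\<dots> = \<delta> / 2 *
        (\<Sum>z\<in>{1..b (Suc k)}. ?d * max 0 (1 - pmf D z / ?d))"
      unfolding e_eq using less pos[of k] by (simp add: weight_def del: of_nat_diff flip: sum_distrib_left)
    also have "\<dots> = \<delta> / 2 * deficit b D k"
      unfolding deficit_def
      by (intro arg_cong2[where f = "(*)"] sum.cong refl * pmf_nonneg)
    finally show "(\<Sum>x\<in>{b k<..b (Suc k)}. pmf D x * e k) = \<delta> / 2 * deficit b D k" .
  qed
  finally show ?thesis by (simp add: sum_distrib_left)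
qed

end

section \<open>A grid of geometrically growing cells\<close>

primrec grid :: "real \<Rightarrow> nat \<Rightarrow> nat" where
  "grid \<delta> 0 = 0"
| "grid \<delta> (Suc k) = Suc (grid \<delta> k + nat \<lfloor>\<delta> * real (grid \<delta> k)\<rfloor>)"

lemma strict_mono_grid: "strict_mono (grid \<delta>)"
  by (simp add: strict_mono_Suc_iff less_Suc_eq_le)

lemma grid_Suc_le:
  assumes "\<delta> \<ge> 0"
  shows "real (grid \<delta> (Suc k)) \<le> real (grid \<delta> k) + 1 + \<delta> * real (grid \<delta> k)"
proof -
  have "0 \<le> \<delta> * real (grid \<delta> k)" using assms by simp
  then have "real (nat \<lfloor>\<delta> * real (grid \<delta> k)\<rfloor>) \<le> \<delta> * real (grid \<delta> k)" by linarith
  then show ?thesis by simp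
qed

text \<open>The length \<open>l\<close> of a cell, one more than a floor, is at least \<delta> times
  its left end. Adding \<delta> * \<open>l\<close>, which is at most \<open>l\<close>, gives the
  bound at the right end.\<close>

lemma grid_Suc_long:
  assumes "0 \<le> \<delta>" "\<delta> \<le> 1"
  shows "\<delta> * real (grid \<delta> (Suc k)) \<le> 2 * (real (grid \<delta> (Suc k)) - real (grid \<delta> k))"
proof -
  define l where "l = real (grid \<delta> (Suc k)) - real (grid \<delta> k)"
  have "\<delta> * real (grid \<delta> k) \<le> l" unfolding l_def grid.simps by linarith
  moreover have "0 \<le> l" by (simp add: l_def)
  then have "\<delta> * l \<le> 1 * l" using assms by (intro mult_right_mono)
  moreover have "\<delta> * real (grid \<delta> (Suc k)) = \<delta> * real (grid \<delta> k) + \<delta> * l"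
    by (simp add: l_def algebra_simps)
  ultimately have "\<delta> * real (grid \<delta> (Suc k)) \<le> 2 * l" by linarith
  then show ?thesis by (simp only: l_def)
qed

text \<open>Cells may reach beyond \<open>n\<close>; the mass there is 0, so monotonicity extends to
  all positive integers.\<close>

lemma antimono_on_pmf_monotone_distribution:
  assumes "D \<in> monotone_distributions n"
  shows "antimono_on {1..} (pmf D)"
proof (rule monotone_onI)
  fix x y :: nat assume xy: "x \<in> {1..}" "y \<in> {1..}" "x \<le> y"
  show "pmf D x \<ge> pmf D y"
  proof (cases "y \<le> n")
    case True
    then show ?thesis
      using assms xy monotone_onD[of "{1..n}" "(\<le>)" "(\<ge>)" "pmf D" x y]
      by (simp add: monotone_distributions_def)
  next
    case False
    then have "y \<notin> set_pmf D"
      using assms by (auto simp: monotone_distributions_def distributions_def)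
    then show ?thesis by (simp add: set_pmf_iff)
  qed
qed

section \<open>Numerical estimates and choice of parameters\<close>

lemma one_plus_power_le_exp:
  fixes c :: real
  assumes "0 \<le> 1 + c"
  shows "(1 + c) ^ m \<le> exp (c * real m)"
proof -
  have "(1 + c) ^ m \<le> exp c ^ m" using assms by (intro power_mono) auto
  then show ?thesis by (simp add: exp_of_nat2_mult)
qed

text \<open>The quadratic Taylor bound gives exp (4/3) \<ge> 29/9. The value 4/3 is the margin left
  by the rejection tail below.\<close>

lemma exp_le_third:
  fixes c :: real
  assumes "c \<le> - 4 / 3"
  shows "exp c \<le> 1 / 3"
proof -
  have "3 \<le> exp (4 / 3 :: real)"
    using exp_lower_Taylor_quadratic[of "4 / 3 :: real"] by (simp add: power2_eq_square)
  also have "\<dots> \<le> exp (- c)" using assms by simp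
  finally show ?thesis by (simp add: exp_minus field_simps)
qed

theorem theorem6p1:
  "\<exists>(A :: nat \<Rightarrow> real \<Rightarrow> tester) (C :: real) (k :: nat).
     \<forall>(n :: nat) (\<epsilon> :: real). n \<ge> 1 \<longrightarrow> 0 < \<epsilon> \<longrightarrow> \<epsilon> \<le> 1 \<longrightarrow>
       (\<forall>D \<in> distributions n.
          makes_at_most_queries D (A n \<epsilon>) (soft_O_bound C k (1 / \<epsilon> ^ 4)) \<and>
          (D \<in> monotone_distributions n \<longrightarrow> verdict_prob D (A n \<epsilon>) ACCEPT \<ge> 2 / 3) \<and>
          (d_TV_monotone n D \<ge> \<epsilon> \<longrightarrow> verdict_prob D (A n \<epsilon>) REJECT \<ge> 2 / 3))"
proof -
  define \<delta> where "\<delta> \<epsilon> = \<epsilon> / 16" for \<epsilon> :: real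
  \<comment> \<open>The expected total score is at most \<open>r\<close> for monotone and at least
    \<open>4 * r\<close> for far distributions, hence the threshold \<open>2 * r\<close>. This
    \<open>m\<close> makes \<open>r\<close> at least 4, enough for both tails.\<close>
  define m where "m \<epsilon> = nat \<lceil>4 / (\<delta> \<epsilon>)\<^sup>2\<rceil>" for \<epsilon> :: real
  define r where "r \<epsilon> = (\<delta> \<epsilon>)\<^sup>2 * real (m \<epsilon>)" for \<epsilon> :: real
  define A where "A n \<epsilon> = repeat_trials (grid (\<delta> \<epsilon>)) (\<delta> \<epsilon>) (2 * r \<epsilon>) (m \<epsilon>) 0" for n :: nat and \<epsilon>
  \<comment> \<open>At most 1024 / \<epsilon>^2 + 1 \<le> 1025 / \<epsilon>^4 rounds of 5 queries
    give the constant 5125, with no logarithmic factor.\<close>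
  have main: "makes_at_most_queries D (A n \<epsilon>) (soft_O_bound 5125 0 (1 / \<epsilon> ^ 4)) \<and>
          (D \<in> monotone_distributions n \<longrightarrow> verdict_prob D (A n \<epsilon>) ACCEPT \<ge> 2 / 3) \<and>
          (d_TV_monotone n D \<ge> \<epsilon> \<longrightarrow> verdict_prob D (A n \<epsilon>) REJECT \<ge> 2 / 3)"
    if n: "n \<ge> 1" and \<epsilon>: "0 < \<epsilon>" "\<epsilon> \<le> 1" and D: "D \<in> distributions n" for n \<epsilon> D
  proof (intro conjI impI)
    let ?b = "grid (\<delta> \<epsilon>)"
    define \<mu> where "\<mu> = measure_pmf.expectation (trial ?b (\<delta> \<epsilon>) D) id"
    have \<delta>: "0 < \<delta> \<epsilon>" "\<delta> \<epsilon> \<le> 1" using \<epsilon> by (auto simp: \<delta>_def)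
    note grid = grid.simps(1)[of "\<delta> \<epsilon>"] strict_mono_grid[of "\<delta> \<epsilon>"]
    have fin: "finite (set_pmf D)"
      using D finite_subset by (auto simp: distributions_def)
    have \<mu>: "\<mu> = \<delta> \<epsilon> / 2 * (\<Sum>k<n. deficit ?b D k)"
      unfolding \<mu>_def by (rule expectation_trial[OF grid D])
    have range: "set_pmf (trial ?b (\<delta> \<epsilon>) D) \<subseteq> {0..1}"
      using \<delta> by (intro set_pmf_trial_subset grid grid_Suc_long) auto
    have "0 \<le> y \<and> y \<le> 1" if "y \<in> set_pmf (trial ?b (\<delta> \<epsilon>) D)" for y
      using subsetD[OF range that] by simp
    then have "0 \<le> \<mu>" "\<mu> \<le> 1"
      unfolding \<mu>_def
      by (auto intro!: integral_nonneg_AE measure_pmf.integral_le_const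
          integrable_measure_pmf_finite finite_set_pmf_trial grid fin simp: AE_measure_pmf_iff)
    note bound = verdict_prob_repeat_trials_le[OF _ finite_set_pmf_trial[OF grid fin] range,
        folded \<mu>_def, where s = 0 and m = "m \<epsilon>" and t = "2 * r \<epsilon>", folded A_def[of n]]
    have "4 / (\<delta> \<epsilon>)\<^sup>2 \<le> real (m \<epsilon>)" unfolding m_def by linarith
    then have r: "4 \<le> r \<epsilon>" using \<delta> by (simp add: r_def field_simps)
    {
      have "real (m \<epsilon>) \<le> 4 / (\<delta> \<epsilon>)\<^sup>2 + 1"
        unfolding m_def by (simp add: of_nat_nat)
      also have "\<dots> = 1024 / \<epsilon>\<^sup>2 + 1" by (simp add: \<delta>_def power_divide)
      also have "\<dots> \<le> 1025 / \<epsilon> ^ 4"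
      proof -
        have "\<epsilon> ^ 4 \<le> \<epsilon>\<^sup>2" "\<epsilon> ^ 4 \<le> 1"
          using \<epsilon> by (auto intro: power_decreasing power_le_one)
        then have "1024 / \<epsilon>\<^sup>2 \<le> 1024 / \<epsilon> ^ 4" "1 \<le> 1 / \<epsilon> ^ 4"
          using \<epsilon> by (auto intro!: divide_left_mono)
        then show ?thesis by (simp add: field_simps)
      qed
      finally show "makes_at_most_queries D (A n \<epsilon>) (soft_O_bound 5125 0 (1 / \<epsilon> ^ 4))"
        unfolding makes_at_most_queries_def A_def soft_O_bound_def
        by (auto dest!: queries_repeat_trials)
    }
    {
      assume "D \<in> monotone_distributions n"
      then have "(\<Sum>k<n. deficit ?b D k) \<le> 2 * \<delta> \<epsilon>"
        using \<delta> by (intro sum_deficit_le grid grid_Suc_le antimono_on_pmf_monotone_distribution) auto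
      then have "\<mu> \<le> \<delta> \<epsilon> / 2 * (2 * \<delta> \<epsilon>)"
        unfolding \<mu> using \<delta> by (intro mult_left_mono) auto
      then have "\<mu> * real (m \<epsilon>) \<le> r \<epsilon>"
        by (simp add: r_def power2_eq_square mult_right_mono)
      have "verdict_prob D (A n \<epsilon>) REJECT \<le> 2 powr (0 - 2 * r \<epsilon>) * (1 + (2 - 1) * \<mu>) ^ m \<epsilon>"
        by (rule bound) (auto intro!: ge_one_powr_ge_zero split: if_splits)
      also have "\<dots> \<le> exp (- 2 * r \<epsilon> * ln 2) * exp (\<mu> * real (m \<epsilon>))"
        using one_plus_power_le_exp[of \<mu> "m \<epsilon>"] \<open>0 \<le> \<mu>\<close>
        by (intro mult_mono) (auto simp: powr_def)
      also have "\<dots> = exp (\<mu> * real (m \<epsilon>) - 2 * r \<epsilon> * ln 2)"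
        by (simp flip: exp_add)
      also have "\<dots> \<le> 1 / 3"
      proof (rule exp_le_third)
        \<comment> \<open>The exponent is then at most r - (4/3) r = - r / 3.\<close>
        have "r \<epsilon> * (2 / 3) \<le> r \<epsilon> * ln 2"
          using r ln2_ge_two_thirds by (intro mult_left_mono) auto
        then show "\<mu> * real (m \<epsilon>) - 2 * r \<epsilon> * ln 2 \<le> - 4 / 3"
          using \<open>\<mu> * real (m \<epsilon>) \<le> r \<epsilon>\<close> r by linarith
      qed
      finally show "verdict_prob D (A n \<epsilon>) ACCEPT \<ge> 2 / 3"
        by (simp add: verdict_prob_ACCEPT)
    }
    {
      assume "d_TV_monotone n D \<ge> \<epsilon>"
      then have "\<epsilon> / 2 \<le> (\<Sum>k<n. deficit ?b D k)"
        using d_TV_monotone_le_deficit[OF grid n D] by simp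
      then have "\<delta> \<epsilon> / 2 * (\<epsilon> / 2) \<le> \<mu>"
        unfolding \<mu> using \<delta> by (intro mult_left_mono) auto
      then have "4 * (\<delta> \<epsilon>)\<^sup>2 \<le> \<mu>" by (simp add: \<delta>_def power2_eq_square)
      then have "4 * (\<delta> \<epsilon>)\<^sup>2 * real (m \<epsilon>) \<le> \<mu> * real (m \<epsilon>)"
        by (intro mult_right_mono) auto
      then have \<mu>r: "4 * r \<epsilon> \<le> \<mu> * real (m \<epsilon>)" by (simp add: r_def)
      have "verdict_prob D (A n \<epsilon>) ACCEPT
          \<le> (1 / 2) powr (0 - 2 * r \<epsilon>) * (1 + (1 / 2 - 1) * \<mu>) ^ m \<epsilon>"
      proof (rule bound)
        fix s assume "(if s \<le> 2 * r \<epsilon> then ACCEPT else REJECT) = ACCEPT"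
        then have "s \<le> 2 * r \<epsilon>" by (simp split: if_splits)
        then show "1 \<le> (1 / 2) powr (s - 2 * r \<epsilon>)"
          by (simp add: powr_def ln_div mult_le_0_iff)
      qed simp
      also have "\<dots> \<le> exp (2 * r \<epsilon> * ln 2) * exp (- \<mu> / 2 * real (m \<epsilon>))"
        using one_plus_power_le_exp[of "- \<mu> / 2" "m \<epsilon>"] \<open>\<mu> \<le> 1\<close>
        by (intro mult_mono) (auto simp: powr_def ln_div)
      also have "\<dots> = exp (2 * r \<epsilon> * ln 2 - \<mu> * real (m \<epsilon>) / 2)"
        by (simp flip: exp_add)
      also have "\<dots> \<le> 1 / 3"
      proof (rule exp_le_third)
        \<comment> \<open>The exponent is then at most (25/18 - 2) r = - (11/18) r.\<close>
        have "r \<epsilon> * ln 2 \<le> r \<epsilon> * (25 / 36)"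
          using r ln2_le_25_over_36 by (intro mult_left_mono) auto
        then show "2 * r \<epsilon> * ln 2 - \<mu> * real (m \<epsilon>) / 2 \<le> - 4 / 3"
          using \<mu>r r by linarith
      qed
      finally show "verdict_prob D (A n \<epsilon>) REJECT \<ge> 2 / 3"
        by (simp add: verdict_prob_ACCEPT)
    }
  qed
  show ?thesis
    by (rule exI[of _ A], rule exI[of _ 5125], rule exI[of _ 0]) (use main in blast)
qed

end
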